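(* Let $\mu,\nu,t\in\mathbb{C}$ with $\Re(\mu+\nu)>-1$, $t\ne0$. Let $r_N,\bar r_N$ be the reflection coefficients of the weight $w(z)=(1+z)^\mu(1+1/z)^\nu e^{tz}$ on the unit circle, and let $x_N,y_N$ ($N\ge0$) be the Hamiltonian variables of the Painlevé V system, i.e. the quantities determined by $$x_N+x_{N-1}=\frac{t}{y_N}-\frac{N}{1-y_N}\quad(N\ge1),\qquad y_Ny_{N+1}=t\,\frac{x_N+N+1+\nu+\frac12\mu}{x_N^2-\frac14\mu^2}\quad(N\ge0),$$ $$x_0=t+\tfrac12\mu+t\frac{d}{dt}\log{}_1F_1(-\nu;\mu+1;-t),\qquad y_0=1.$$ Assume the parameters are such that $I^0_N[w]\neq0$, $r_N\ne0$, $\bar r_N\neq0$ for all $N\ge 0$, that this recurrence is well defined for all $N$, and that all denominators occurring below are nonzero. Then $$\Big(\frac1{y_N}-1\Big)\Big[x_N-\frac t{y_N}-\nu-\tfrac12\mu\Big]+N=(N+\nu)(1-r_N\bar r_N)\qquad (N\ge0),$$ $$\Big[x_N-\frac t{y_N}-\nu-\tfrac12\mu\Big]\left(1+\frac{N+\nu}{\big(x_N-\frac{t}{y_N}-\frac12\mu\big)(1-y_N)-\nu}\right)-N=t\,\frac{r_{N+1}}{r_N}(1-r_N\bar r_N)\qquad (N\ge0),$$ $$(1-y_N)\Big[x_N-\frac t{y_N}+\tfrac12\mu\Big]+N=-t\,\frac{\bar r_{N-1}}{\bar r_N}(1-r_N\bar r_N)\qquad (N\ge1).$$ Consequently, for $N\ge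 0$, $$y_N=\frac{\nu+t\,r_{N+1}\bar r_N}{\bar r_N\,[\,t\,r_{N+1}+(N+\nu)r_N\,]},\qquad x_N-\frac t{y_N}-\tfrac12\mu=-t\,r_{N+1}\bar r_N.$$
   Context: On the unit circle, $w(e^{i\theta})=e^{i\theta(\mu-\nu)/2}\,|1+e^{i\theta}|^{\mu+\nu}\,e^{te^{i\theta}}$ for $-\pi<\theta\le\pi$ (principal branches). Its Fourier coefficients are $w_k=\frac1{2\pi}\int_{-\pi}^{\pi}w(e^{i\theta})e^{-ik\theta}\,d\theta$, $k\in\mathbb{Z}$. For $\epsilon\in\{0,1,-1\}$ put $I^\epsilon_N[w]=\det[w_{-\epsilon+j-k}]_{0\le j,k\le N-1}$, $I^\epsilon_0[w]=1$. The reflection coefficients are $r_N=(-1)^N I^1_N[w]/I^0_N[w]$ and $\bar r_N=(-1)^N I^{-1}_N[w]/I^0_N[w]$ (so $r_0=\bar r_0=1$); these are in general two independent quantities and the bar does not mean complex conjugation. The Fourier coefficients are explicitly $w_k=\frac{\Gamma(\mu+\nu+1)}{\Gamma(\mu+1-k)\Gamma(\nu+1+k)}\,{}_1F_1(-k-\nu;\mu-k+1;-t)$. In terms of the canonical variables $q_N,p_N$ of the Painlevé V Hamiltonian system, $x_N=(p_N+t)q_N+\frac12\mu$ and $y_N=1/q_N$. *)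

theory Defs
  imports "HOL-Analysis.Analysis" "Jordan_Normal_Form.Determinant"
begin

text \<open>The value at \<open>z = exp (\<i> * \<theta>)\<close>, for \<open>\<theta>\<close> in \<open>{-pi<..pi}\<close>, of the weight
  \<open>(1 + z) powr \<mu> * (1 + 1 / z) powr \<nu> * exp (t * z)\<close> with principal branches.\<close>

definition weight :: "complex \<Rightarrow> complex \<Rightarrow> complex \<Rightarrow> real \<Rightarrow> complex" where
  "weight \<mu> \<nu> t \<theta> =
     exp (\<i> * of_real \<theta> * (\<mu> - \<nu>) / 2)
     * complex_of_real (cmod (1 + exp (\<i> * of_real \<theta>))) powr (\<mu> + \<nu>)
     * exp (t * exp (\<i> * of_real \<theta>))"

definition weight_coeff :: "complex \<Rightarrow> complex \<Rightarrow> complex \<Rightarrow> int \<Rightarrow> complex" where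
  "weight_coeff \<mu> \<nu> t k =
     1 / (2 * of_real pi)
     * integral {-pi..pi} (\<lambda>\<theta>. weight \<mu> \<nu> t \<theta> * exp (- \<i> * of_int k * of_real \<theta>))"

text \<open>The determinant of the matrix of dimension zero is one, so the convention for \<open>N = 0\<close>
  is built in.\<close>

definition toeplitz_det :: "int \<Rightarrow> complex \<Rightarrow> complex \<Rightarrow> complex \<Rightarrow> nat \<Rightarrow> complex" where
  "toeplitz_det \<epsilon> \<mu> \<nu> t N =
     Determinant.det
       (Matrix.mat N N (\<lambda>(j, k). weight_coeff \<mu> \<nu> t (- \<epsilon> + int j - int k)))"

definition refl_coeff :: "complex \<Rightarrow> complex \<Rightarrow> complex \<Rightarrow> nat \<Rightarrow> complex" where
  "refl_coeff \<mu> \<nu> t N = (-1) ^ N * toeplitz_det 1 \<mu> \<nu> t N / toeplitz_det 0 \<mu> \<nu> t N"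

text \<open>The second family of reflection coefficients. It is not the complex conjugate of
  \<open>refl_coeff\<close>.\<close>

definition refl_coeff_bar :: "complex \<Rightarrow> complex \<Rightarrow> complex \<Rightarrow> nat \<Rightarrow> complex" where
  "refl_coeff_bar \<mu> \<nu> t N = (-1) ^ N * toeplitz_det (-1) \<mu> \<nu> t N / toeplitz_det 0 \<mu> \<nu> t N"

text \<open>Kummer's function \<open>\<^sub>1F\<^sub>1(a; b; z)\<close>, meaningful only if \<open>b\<close> is not a nonpositive integer.\<close>

definition kummer :: "complex \<Rightarrow> complex \<Rightarrow> complex \<Rightarrow> complex" where
  "kummer a b z = eval_fps (fps_hypergeo [a] [b] 1) z"

text \<open>Being a derivative, \<open>d/dt log f\<close> does not depend on the choice of a branch of the
  logarithm; it is therefore the quotient \<open>f'/f\<close> (the principal value \<open>Ln\<close> would not be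
  differentiable where \<open>f\<close> crosses its cut).\<close>

definition log_deriv :: "(complex \<Rightarrow> complex) \<Rightarrow> complex \<Rightarrow> complex" where
  "log_deriv f t = deriv f t / f t"

text \<open>\<open>x\<close> and \<open>y\<close> form the solution of the recurrence with the given initial values; the
  inequations say that no denominator of the recurrence vanishes, so that the recurrence
  determines \<open>x\<close> and \<open>y\<close>. As \<open>y 0 = 1\<close>, the denominator \<open>1 - y N\<close> is required to be nonzero
  only for \<open>N \<ge> 1\<close>. The condition on \<open>\<mu> + 1\<close> makes the initial value of \<open>x\<close> meaningful.\<close>

definition hamiltonian_variables ::
  "complex \<Rightarrow> complex \<Rightarrow> complex \<Rightarrow> (nat \<Rightarrow> complex) \<Rightarrow> (nat \<Rightarrow> complex) \<Rightarrow> bool" where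
  "hamiltonian_variables \<mu> \<nu> t x y \<longleftrightarrow>
     \<mu> + 1 \<notin> \<int>\<^sub>\<le>\<^sub>0 \<and>
     x 0 = t + \<mu> / 2 + t * log_deriv (\<lambda>s. kummer (- \<nu>) (\<mu> + 1) (- s)) t \<and>
     y 0 = 1 \<and>
     (\<forall>N. y N \<noteq> 0) \<and>
     (\<forall>N\<ge>1. 1 - y N \<noteq> 0) \<and>
     (\<forall>N. (x N)^2 - \<mu>^2 / 4 \<noteq> 0) \<and>
     (\<forall>N\<ge>1. x N + x (N - 1) = t / y N - of_nat N / (1 - y N)) \<and>
     (\<forall>N. y N * y (N + 1) = t * (x N + of_nat N + 1 + \<nu> + \<mu> / 2) / ((x N)^2 - \<mu>^2 / 4))"

end

theory Submission
  imports Defs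
begin

text \<open>The weight satisfies a first order differential equation with polynomial coefficients, so its
  Fourier coefficients satisfy a three-term recurrence. Applied to the monic orthogonal polynomial
  \<open>P n\<close> (with \<open>P n (0) = r n\<close>) and to the reversed polynomial \<open>Q n\<close> of its biorthogonal partner
  (with leading coefficient \<open>rbar n\<close>), the recurrence gives differential equations whose
  derivative terms carry the factor \<open>1 + z\<close>. At \<open>z = -1\<close> they become linear relations between
  \<open>u = P n (-1)\<close> and \<open>v = Q n (-1)\<close>. Together with the Szego recursion these relations show
  that \<open>y = v / (rbar u)\<close> and \<open>x = t / y + \<mu> / 2 - t r' rbar\<close>, where \<open>r'\<close> is the next reflection
  coefficient, solve the recurrence of the Hamiltonian variables. The initial value agrees because
  differentiation in \<open>t\<close> multiplies the weight by \<open>z\<close>, so that the zeroth Fourier coefficient, a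
  multiple of Kummer's function, has the coefficient of index \<open>-1\<close> as its derivative.\<close>

section \<open>Orthogonal polynomials of a Toeplitz moment functional\<close>

text \<open>If \<open>w\<close> is the sequence of Fourier coefficients of a weight, this is the \<open>j\<close>-th Fourier
  coefficient of \<open>f\<close> times the weight.\<close>

definition moment_functional :: "(int \<Rightarrow> 'a::comm_ring_1) \<Rightarrow> int \<Rightarrow> 'a poly \<Rightarrow> 'a" where
  "moment_functional w j f = (\<Sum>i\<le>degree f. coeff f i * w (j - int i))"

lemma moment_functional_eq_sum:
  assumes "\<And>i. i > n \<Longrightarrow> coeff f i = 0"
  shows "moment_functional w j f = (\<Sum>i\<le>n. coeff f i * w (j - int i))"
proof -
  have "degree f \<le> n" using assms by (intro degree_le) auto
  then show ?thesis unfolding moment_functional_def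
    by (intro sum.mono_neutral_left) (auto simp: coeff_eq_0)
qed

lemma moment_functional_0 [simp]: "moment_functional w j 0 = 0"
  by (simp add: moment_functional_def)

lemma moment_functional_add [simp]:
  "moment_functional w j (f + g) = moment_functional w j f + moment_functional w j g"
proof -
  define n where "n = max (degree f) (degree g)"
  have "coeff f i = 0" "coeff g i = 0" "coeff (f + g) i = 0" if "i > n" for i
    using that by (auto simp: n_def coeff_eq_0)
  then show ?thesis
    by (simp add: moment_functional_eq_sum[of n] distrib_right sum.distrib)
qed

lemma moment_functional_smult [simp]:
  "moment_functional w j (Polynomial.smult a f) = a * moment_functional w j f"
  by (subst moment_functional_eq_sum[of "degree f"])
    (auto simp: moment_functional_def coeff_eq_0 sum_distrib_left mult.assoc)

lemma moment_functional_minus [simp]: "moment_functional w j (- f) = - moment_functional w j f"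
  using moment_functional_smult[of w j "-1" f] by simp

lemma moment_functional_diff [simp]:
  "moment_functional w j (f - g) = moment_functional w j f - moment_functional w j g"
  using moment_functional_add[of w j f "- g"] by simp

lemma moment_functional_pCons [simp]:
  "moment_functional w j (pCons a f) = a * w j + moment_functional w (j - 1) f"
proof -
  have "moment_functional w j (pCons a f)
      = (\<Sum>i\<le>Suc (degree f). coeff (pCons a f) i * w (j - int i))"
    by (rule moment_functional_eq_sum)
      (auto simp: coeff_pCons coeff_eq_0 split: nat.split)
  also have "\<dots> = a * w j + moment_functional w (j - 1) f"
    by (simp add: moment_functional_def sum.atMost_Suc_shift del: sum.atMost_Suc)
      (simp add: algebra_simps)
  finally show ?thesis .
qed

text \<open>Integration by parts in coefficient form: a shift of the index is multiplication by a
  power of z, so the left side tests z (1 + z) f' against the weight. The induction writes a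
  polynomial as a + z f. The extra term f from the product rule turns the factors for index j - 1
  into those for j, and the hypothesis covers the constant a.\<close>

lemma moment_functional_pderiv:
  fixes w :: "int \<Rightarrow> 'a::idom"
  assumes "\<And>k. (of_int k + \<nu>) * w k + (of_int k - 1 - \<mu> - t) * w (k - 1) - t * w (k - 2) = 0"
  shows "moment_functional w (j - 1) (pderiv f) + moment_functional w (j - 2) (pderiv f)
    = (of_int j + \<nu>) * moment_functional w j f
      + (of_int j - 1 - \<mu> - t) * moment_functional w (j - 1) f
      - t * moment_functional w (j - 2) f"
proof (induction f arbitrary: j)
  case 0
  show ?case by simp
next
  case (pCons a f)
  have "moment_functional w (j - 1) (pderiv (pCons a f))
      + moment_functional w (j - 2) (pderiv (pCons a f))
    = moment_functional w (j - 1) f + moment_functional w (j - 2) f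
      + (moment_functional w (j - 1 - 1) (pderiv f) + moment_functional w (j - 1 - 2) (pderiv f))"
    by (simp add: pderiv_pCons)
  also note pCons.IH[of "j - 1"]
  finally have 1: "moment_functional w (j - 1) (pderiv (pCons a f))
      + moment_functional w (j - 2) (pderiv (pCons a f))
    = (of_int j + \<nu>) * moment_functional w (j - 1) f
      + (of_int j - 1 - \<mu> - t) * moment_functional w (j - 2) f
      - t * moment_functional w (j - 3) f"
    by (simp add: algebra_simps)
  have 2: "a * ((of_int j + \<nu>) * w j + (of_int j - 1 - \<mu> - t) * w (j - 1) - t * w (j - 2)) = 0"
    using assms[of j] by simp
  show ?case unfolding 1 using 2 by (simp add: algebra_simps)
qed

text \<open>Nonvanishing of all Toeplitz determinants gives existence and uniqueness of the
  biorthogonal polynomials. Their algebra takes place over an arbitrary field.\<close>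

locale regular_moments =
  fixes w :: "int \<Rightarrow> 'a::field"
  assumes regular: "Determinant.det (Matrix.mat n n (\<lambda>(j, k). w (int j - int k))) \<noteq> 0"
begin

abbreviation L :: "int \<Rightarrow> 'a poly \<Rightarrow> 'a" where
  "L \<equiv> moment_functional w"

definition toep :: "int \<Rightarrow> nat \<Rightarrow> 'a" where
  "toep e n = Determinant.det (Matrix.mat n n (\<lambda>(j, k). w (- e + int j - int k)))"

definition refl :: "nat \<Rightarrow> 'a" where
  "refl n = (-1) ^ n * toep 1 n / toep 0 n"

definition refl_bar :: "nat \<Rightarrow> 'a" where
  "refl_bar n = (-1) ^ n * toep (-1) n / toep 0 n"

text \<open>The norm of the biorthogonal pair, that is, the common value of
  \<open>L (int n) (P n)\<close> and \<open>L 0 (Q n)\<close>.\<close>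

definition norm_const :: "nat \<Rightarrow> 'a" where
  "norm_const n = toep 0 (Suc n) / toep 0 n"

abbreviation toep_mat :: "nat \<Rightarrow> 'a mat" where
  "toep_mat n \<equiv> Matrix.mat n n (\<lambda>(j, k). w (int j - int k))"

text \<open>Cramer's rule: the coefficients are column \<open>k\<close> of the adjugate of the
  Toeplitz matrix, scaled so that \<open>P n\<close> becomes monic and \<open>Q n\<close> gets
  constant term 1.\<close>

definition cof_poly :: "nat \<Rightarrow> nat \<Rightarrow> 'a poly" where
  "cof_poly n k = (\<Sum>i\<le>n. monom (cofactor (toep_mat (Suc n)) k i / toep 0 n) i)"

text \<open>The monic orthogonal polynomial and the reversed polynomial of its partner.\<close>

abbreviation P :: "nat \<Rightarrow> 'a poly" where
  "P n \<equiv> cof_poly n n"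

abbreviation Q :: "nat \<Rightarrow> 'a poly" where
  "Q n \<equiv> cof_poly n 0"

section \<open>Biorthogonality and uniqueness\<close>

lemma toep_nonzero: "toep 0 n \<noteq> 0"
  using regular[of n] by (simp add: toep_def)

lemma norm_const_nonzero: "norm_const n \<noteq> 0"
  by (simp add: norm_const_def toep_nonzero)

lemma coeff_cof_poly:
  "coeff (cof_poly n k) i = (if i \<le> n then cofactor (toep_mat (Suc n)) k i / toep 0 n else 0)"
  by (simp add: cof_poly_def coeff_sum)

text \<open>This is entry \<open>(j, k)\<close> of \<open>M * adj_mat M\<close>, which is the
  determinant times the identity matrix.\<close>

lemma L_cof_poly:
  assumes "j \<le> n" "k \<le> n"
  shows "L (int j) (cof_poly n k) = (if j = k then norm_const n else 0)"
proof -
  define M where "M = toep_mat (Suc n)"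
  have M: "M \<in> carrier_mat (Suc n) (Suc n)" by (simp add: M_def)
  have "L (int j) (cof_poly n k) = (\<Sum>i\<le>n. coeff (cof_poly n k) i * w (int j - int i))"
    by (rule moment_functional_eq_sum) (simp add: coeff_cof_poly)
  also have "\<dots> = (\<Sum>i\<in>{0..<Suc n}. M $$ (j, i) * cofactor M k i) / toep 0 n"
    unfolding sum_divide_distrib
    by (rule sum.cong) (use assms in \<open>auto simp: coeff_cof_poly M_def\<close>)
  also have "(\<Sum>i\<in>{0..<Suc n}. M $$ (j, i) * cofactor M k i) = (M * adj_mat M) $$ (j, k)"
    using assms M by (auto simp: adj_mat_def scalar_prod_def times_mat_def intro!: sum.cong)
  also have "\<dots> = (if j = k then toep 0 (Suc n) else 0)"
    using assms by (simp add: adj_mat(2)[OF M]) (simp add: M_def toep_def)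
  finally show ?thesis by (simp add: norm_const_def)
qed

lemma L_P: "j \<le> n \<Longrightarrow> L (int j) (P n) = (if j = n then norm_const n else 0)"
  by (rule L_cof_poly) auto

lemma L_Q: "j \<le> n \<Longrightarrow> L (int j) (Q n) = (if j = 0 then norm_const n else 0)"
  by (rule L_cof_poly) auto

text \<open>Removing a corner row and column of a Toeplitz matrix leaves a Toeplitz matrix, shifted
  by one for the two off-diagonal corners. In this way the reflection coefficients become end
  coefficients of \<open>P n\<close> and \<open>Q n\<close>.\<close>

lemma det_mat_delete_toep:
  "Determinant.det (mat_delete (toep_mat (Suc n)) n n) = toep 0 n"
  "Determinant.det (mat_delete (toep_mat (Suc n)) n 0) = toep 1 n"
  "Determinant.det (mat_delete (toep_mat (Suc n)) 0 0) = toep 0 n"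
  "Determinant.det (mat_delete (toep_mat (Suc n)) 0 n) = toep (-1) n"
  unfolding toep_def
  by (auto simp: mat_delete_def algebra_simps intro!: arg_cong[of _ _ Determinant.det]
      arg_cong[of _ _ w] eq_matI)

lemma coeff_P_top: "coeff (P n) n = 1"
  and coeff_P_0: "coeff (P n) 0 = refl n"
  and coeff_Q_0: "coeff (Q n) 0 = 1"
  and coeff_Q_top: "coeff (Q n) n = refl_bar n"
  and coeff_P_above: "i > n \<Longrightarrow> coeff (P n) i = 0"
  and coeff_Q_above: "i > n \<Longrightarrow> coeff (Q n) i = 0"
  by (simp_all add: coeff_cof_poly cofactor_def det_mat_delete_toep refl_def refl_bar_def
      toep_nonzero)

lemma refl_bar_0: "refl_bar 0 = 1"
  using coeff_Q_0[of 0] coeff_Q_top[of 0] by simp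

text \<open>The coefficient vector lies in the kernel of a nonsingular Toeplitz matrix. The
  polynomial identities below follow by applying this criterion, or its shifted form, to the
  difference of the two sides.\<close>

lemma eq_0_if_L_eq_0:
  assumes deg: "\<And>i. i \<ge> n \<Longrightarrow> coeff f i = 0" and L: "\<And>j. j < n \<Longrightarrow> L (int j) f = 0"
  shows "f = 0"
proof (rule ccontr)
  assume "f \<noteq> 0"
  define v where "v = Matrix.vec n (coeff f)"
  have v: "v \<in> carrier_vec n" by (simp add: v_def)
  have "v \<noteq> 0\<^sub>v n"
  proof
    assume "v = 0\<^sub>v n"
    then have "vec_index v i = 0" if "i < n" for i using that by simp
    then have "coeff f i = 0" for i
      by (cases "i < n") (auto simp: v_def deg)
    then show False using \<open>f \<noteq> 0\<close> by (simp add: poly_eq_iff)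
  qed
  moreover have "toep_mat n *\<^sub>v v = 0\<^sub>v n"
  proof (rule eq_vecI)
    fix j assume j: "j < dim_vec (0\<^sub>v n :: 'a Matrix.vec)"
    then have n: "n > 0" by simp
    have "L (int j) f = (\<Sum>i\<le>n - 1. coeff f i * w (int j - int i))"
      by (rule moment_functional_eq_sum) (use deg in auto)
    also have "{..n - 1} = {0..<n}" using n by auto
    finally show "vec_index (toep_mat n *\<^sub>v v) j = vec_index (0\<^sub>v n) j"
      using L[of j] j by (simp add: v_def scalar_prod_def mult.commute)
  qed (simp add: v_def)
  ultimately have "Determinant.det (toep_mat n) = 0"
    using v det_0_iff_vec_prod_zero[of "toep_mat n" n] by auto
  then show False using regular by simp
qed

text \<open>Division by z lowers every tested index by one and leads back to the unshifted
  criterion.\<close>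

lemma eq_0_if_L_eq_0_shift:
  assumes "\<And>i. i > n \<Longrightarrow> coeff f i = 0" and "coeff f 0 = 0"
    and "\<And>j. 1 \<le> j \<Longrightarrow> j \<le> n \<Longrightarrow> L (int j) f = 0"
  shows "f = 0"
proof -
  obtain g where f: "f = pCons 0 g" using assms(2) by (metis coeff_pCons_0 pCons_cases)
  have "g = 0"
  proof (rule eq_0_if_L_eq_0[of n])
    show "coeff g i = 0" if "i \<ge> n" for i
      using assms(1)[of "Suc i"] that by (simp add: f)
    show "L (int j) g = 0" if "j < n" for j
      using assms(3)[of "Suc j"] that by (simp add: f)
  qed
  then show ?thesis by (simp add: f)
qed

section \<open>Szego recursion and norms\<close>

text \<open>All three polynomials are annihilated at the indices 1 to \<open>n\<close>. The leading
  terms of \<open>P (Suc n)\<close> and z \<open>P n\<close> cancel, and the multiple of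
  \<open>Q n\<close> matches the constant term, so the shifted criterion applies.\<close>

lemma P_Suc: "P (Suc n) = pCons 0 (P n) + Polynomial.smult (refl (Suc n)) (Q n)"
proof -
  have "P (Suc n) - pCons 0 (P n) - Polynomial.smult (refl (Suc n)) (Q n) = 0"
  proof (rule eq_0_if_L_eq_0_shift[of n])
    fix i assume "i > n"
    then show "coeff (P (Suc n) - pCons 0 (P n) - Polynomial.smult (refl (Suc n)) (Q n)) i = 0"
      by (cases i; cases "i = Suc n") (auto simp: coeff_P_top coeff_P_above coeff_Q_above)
  next
    fix j assume "1 \<le> j" "j \<le> n"
    moreover from this have "int j - 1 = int (j - 1)" by simp
    ultimately show "L (int j) (P (Suc n) - pCons 0 (P n) - Polynomial.smult (refl (Suc n)) (Q n)) = 0"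
      by (simp add: L_P L_Q del: of_nat_diff)
  qed (simp add: coeff_P_0 coeff_Q_0)
  then show ?thesis by (simp add: algebra_simps)
qed

lemma Q_Suc: "Q (Suc n) = Q n + Polynomial.smult (refl_bar (Suc n)) (pCons 0 (P n))"
proof -
  have "Q (Suc n) - Q n - Polynomial.smult (refl_bar (Suc n)) (pCons 0 (P n)) = 0"
  proof (rule eq_0_if_L_eq_0_shift[of n])
    fix i assume "i > n"
    then show "coeff (Q (Suc n) - Q n - Polynomial.smult (refl_bar (Suc n)) (pCons 0 (P n))) i = 0"
      by (cases i; cases "i = Suc n")
        (auto simp: coeff_P_top coeff_Q_top coeff_P_above coeff_Q_above)
  next
    fix j assume "1 \<le> j" "j \<le> n"
    moreover from this have "int j - 1 = int (j - 1)" by simp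
    ultimately show "L (int j) (Q (Suc n) - Q n - Polynomial.smult (refl_bar (Suc n)) (pCons 0 (P n))) = 0"
      by (simp add: L_P L_Q del: of_nat_diff)
  qed (simp add: coeff_Q_0)
  then show ?thesis by (simp add: algebra_simps)
qed

text \<open>The index -1 is the first one below the orthogonality range of \<open>P n\<close>; the
  value there is read off from the Szego recursion tested at index 0.\<close>

lemma L_P_neg: "L (-1) (P n) = - refl (Suc n) * norm_const n"
proof -
  have "L (int 0) (P (Suc n)) = 0" by (subst L_P) auto
  moreover have "L (int 0) (Q n) = norm_const n" by (subst L_Q) auto
  ultimately show ?thesis
    by (simp add: P_Suc) (metis add_eq_0_iff minus_mult_left add.commute)
qed

lemma L_Q_top: "L (int (Suc n)) (Q n) = - refl_bar (Suc n) * norm_const n"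
proof -
  have "L (int (Suc n)) (Q (Suc n)) = 0" by (subst L_Q) auto
  moreover have "L (int n) (P n) = norm_const n" by (subst L_P) auto
  ultimately show ?thesis
    unfolding Q_Suc by simp (metis add_eq_0_iff2 minus_mult_left)
qed

text \<open>The Szego recursion for \<open>P (Suc n)\<close>, tested at its top index.\<close>

lemma norm_const_Suc: "norm_const (Suc n) = norm_const n * (1 - refl (Suc n) * refl_bar (Suc n))"
proof -
  have "norm_const (Suc n) = L (int (Suc n)) (P (Suc n))" by (subst L_P) auto
  also have "\<dots> = L (int n) (P n) + refl (Suc n) * L (int (Suc n)) (Q n)"
    unfolding P_Suc by simp
  also have "L (int n) (P n) = norm_const n" by (subst L_P) auto
  finally show ?thesis by (simp only: L_Q_top) (simp add: algebra_simps)
qed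

lemma refl_mult_refl_bar_neq_1: "refl (Suc n) * refl_bar (Suc n) \<noteq> 1"
  using norm_const_nonzero[of "Suc n"] by (auto simp: norm_const_Suc)

section \<open>Values at z = -1\<close>

definition u :: "nat \<Rightarrow> 'a" where "u n = poly (P n) (-1)"
definition v :: "nat \<Rightarrow> 'a" where "v n = poly (Q n) (-1)"

lemma u_Suc: "u (Suc n) = - u n + refl (Suc n) * v n"
  by (simp add: u_def v_def P_Suc)

lemma v_Suc: "v (Suc n) = v n - refl_bar (Suc n) * u n"
  unfolding v_def u_def Q_Suc by simp

lemma u_0: "u 0 = 1" and v_0: "v 0 = 1"
proof -
  have "coeff (P 0) i = coeff 1 i" for i
    by (cases i) (use coeff_P_top[of 0] coeff_P_above in auto)
  then have "P 0 = 1" by (simp add: poly_eq_iff)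
  then show "u 0 = 1" "v 0 = 1" by (simp_all add: u_def v_def)
qed

text \<open>The Szego step from \<open>n\<close> to \<open>Suc n\<close> acts on the pair of values
  as a linear map with determinant \<open>refl (Suc n) * refl_bar (Suc n) - 1\<close>, which is
  nonzero.\<close>

lemma u_v_not_both_0: "u n \<noteq> 0 \<or> v n \<noteq> 0"
proof (induction n)
  case 0
  show ?case by (simp add: u_0)
next
  case (Suc n)
  show ?case
  proof (rule ccontr)
    assume "\<not> (u (Suc n) \<noteq> 0 \<or> v (Suc n) \<noteq> 0)"
    then have *: "u n = refl (Suc n) * v n" "v n = refl_bar (Suc n) * u n"
      by (auto simp: u_Suc v_Suc)
    then have "u n * (1 - refl (Suc n) * refl_bar (Suc n)) = 0"
      by (simp add: algebra_simps)
    then have "u n = 0" using refl_mult_refl_bar_neq_1[of n] by auto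
    with * Suc.IH show False by auto
  qed
qed

end

section \<open>Differential equations of the polynomials\<close>

text \<open>The added assumption is the coefficient form of the Pearson equation z (1 + z) w' = (t
  z^2 + (\<mu> + t) z - \<nu>) w.\<close>

locale pearson_moments = regular_moments w for w :: "int \<Rightarrow> 'a::field_char_0" +
  fixes \<mu> \<nu> t :: 'a
  assumes pearson:
    "(of_int k + \<nu>) * w k + (of_int k - 1 - \<mu> - t) * w (k - 1) - t * w (k - 2) = 0"
begin

lemma L_pderiv:
  "L (j - 1) (pderiv f) + L (j - 2) (pderiv f)
    = (of_int j + \<nu>) * L j f + (of_int j - 1 - \<mu> - t) * L (j - 1) f - t * L (j - 2) f"
  by (rule moment_functional_pderiv) (rule pearson)

text \<open>Each coefficient on the right is forced by one test. Index \<open>n\<close> gives the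
  multiple of \<open>P n\<close>, and index 1, where the shift by 2 leaves the orthogonality range,
  gives the multiple of z \<open>Q n\<close>. The constant term then fixes the multiple of
  \<open>Q n\<close>, and the top coefficient that of z \<open>P n\<close>.\<close>

lemma P_differential_equation:
  "pCons 0 (pderiv (P n)) + pCons 0 (pCons 0 (pderiv (P n)))
    = Polynomial.smult (of_nat n - t * refl (Suc n) * refl_bar n) (pCons 0 (P n))
      + Polynomial.smult (of_nat n + \<nu>) (P n)
      - Polynomial.smult ((of_nat n + \<nu>) * refl n) (Q n)
      + Polynomial.smult (t * refl (Suc n)) (pCons 0 (Q n))"
  (is "?l = ?r")
proof -
  have "?l - ?r = 0"
  proof (rule eq_0_if_L_eq_0_shift[of n])
    fix i assume i: "i > n"
    then obtain m where m: "i = Suc m" by (cases i) auto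
    show "coeff (?l - ?r) i = 0"
    proof (cases "m = n")
      case True
      then show ?thesis
        by (cases n) (auto simp: m refl_bar_0 coeff_P_top coeff_Q_top coeff_P_above coeff_Q_above coeff_pderiv
            algebra_simps)
    next
      case False
      then obtain l where "m = Suc l" using i m by (cases m) auto
      then show ?thesis using i m False
        by (auto simp: coeff_P_above coeff_Q_above coeff_pderiv)
    qed
  next
    fix i assume i: "1 \<le> i" "i \<le> n"
    then have i1: "int i - 1 = int (i - 1)" by simp
    have L1: "L (int i - 1) (P n) = 0" using i by (simp add: i1 L_P del: of_nat_diff)
    have L2: "L (int i - 2) (P n) = (if i = 1 then - refl (Suc n) * norm_const n else 0)"
    proof (cases "i = 1")
      case False
      then have "int i - 2 = int (i - 2)" using i by simp
      then show ?thesis using i False by (simp add: L_P del: of_nat_diff)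
    qed (simp add: L_P_neg)
    have "L (int i) ?l = (of_int (int i) + \<nu>) * L (int i) (P n)
        + (of_int (int i) - 1 - \<mu> - t) * L (int i - 1) (P n) - t * L (int i - 2) (P n)"
      using L_pderiv[of "int i" "P n"] by simp
    also have "\<dots> = L (int i) ?r"
      using i L1 L2 by (auto simp: i1 L_P L_Q simp del: of_nat_diff)
    finally show "L (int i) (?l - ?r) = 0" by (subst moment_functional_diff) (simp only: diff_self)
  next
    show "coeff (?l - ?r) 0 = 0" by (simp add: coeff_P_0 coeff_Q_0)
  qed
  then show ?thesis by simp
qed

text \<open>Adding \<open>t\<close> times \<open>Q n\<close> to the derivative cancels the
  contribution of index j - 1, so only the indices j + 1 and j remain. These are nonzero only for j
  = \<open>n\<close> and j = 0, which determine the multiples of \<open>P n\<close> and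
  \<open>Q n\<close>; the top coefficient determines that of z \<open>P n\<close>.\<close>

lemma Q_differential_equation:
  "(pderiv (Q n) + Polynomial.smult t (Q n)) + pCons 0 (pderiv (Q n) + Polynomial.smult t (Q n))
    = Polynomial.smult (t * refl_bar n) (pCons 0 (P n))
      - Polynomial.smult ((of_nat n + 1 + \<nu>) * refl_bar (Suc n)) (P n)
      + Polynomial.smult (t * refl_bar n * refl (Suc n) - \<mu>) (Q n)"
  (is "?l = ?r")
proof -
  have "?l - ?r = 0"
  proof (rule eq_0_if_L_eq_0[of "Suc n"])
    fix i assume i: "i \<ge> Suc n"
    then obtain m where m: "i = Suc m" by (cases i) auto
    show "coeff (?l - ?r) i = 0"
      using i by (cases "m = n")
        (auto simp: m coeff_P_top coeff_Q_top coeff_P_above coeff_Q_above coeff_pderiv)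
  next
    fix j assume "j < Suc n"
    then have j: "j \<le> n" by simp
    have 1: "L (int j) ?l = (of_int (int j + 1) + \<nu>) * L (int j + 1) (Q n)
        + (of_int (int j) - \<mu>) * L (int j) (Q n)"
      using L_pderiv[of "int j + 1" "Q n"] by (simp add: algebra_simps)
    have 2: "L (int j + 1) (Q n) = (if j = n then - refl_bar (Suc n) * norm_const n else 0)"
    proof (cases "j = n")
      case True
      then show ?thesis using L_Q_top[of n] by (simp add: add.commute)
    next
      case False
      then show ?thesis using j L_Q[of "Suc j" n] by (simp add: add.commute)
    qed
    have 3: "L (int j - 1) (P n) = (if j = 0 then - refl (Suc n) * norm_const n else 0)"
    proof (cases j)
      case (Suc m)
      then show ?thesis using j L_P[of m n] by simp
    qed (simp add: L_P_neg)
    have "L (int j) ?l = L (int j) ?r"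
      unfolding 1 using j 2 3 by (auto simp: L_P L_Q algebra_simps)
    then show "L (int j) (?l - ?r) = 0" by (subst moment_functional_diff) (simp only: diff_self)
  qed
  then show ?thesis by simp
qed

text \<open>At \<open>z = -1\<close> the factor \<open>1 + z\<close> in front of the derivatives vanishes, which leaves
  linear relations between \<open>u\<close> and \<open>v\<close>.\<close>

lemma u_v_relation_P:
  "(\<nu> + t * refl (Suc n) * refl_bar n) * u n = (t * refl (Suc n) + (of_nat n + \<nu>) * refl n) * v n"
proof -
  have "0 = - (of_nat n - t * refl (Suc n) * refl_bar n) * u n + (of_nat n + \<nu>) * u n
      - (of_nat n + \<nu>) * refl n * v n - t * refl (Suc n) * v n"
    using arg_cong[OF P_differential_equation[of n], of "\<lambda>f. poly f (-1)"]
    by (simp add: u_def v_def algebra_simps)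
  then show ?thesis by (simp add: algebra_simps)
qed

lemma u_v_relation_Q:
  "(\<mu> - t * refl (Suc n) * refl_bar n) * v n
    = - (t * refl_bar n + (of_nat n + 1 + \<nu>) * refl_bar (Suc n)) * u n"
proof -
  have "0 = - t * refl_bar n * u n - (of_nat n + 1 + \<nu>) * refl_bar (Suc n) * u n
      + (t * refl_bar n * refl (Suc n) - \<mu>) * v n"
    using arg_cong[OF Q_differential_equation[of n], of "\<lambda>f. poly f (-1)"]
    by (simp add: u_def v_def algebra_simps)
  then show ?thesis by (simp add: algebra_simps)
qed

text \<open>If \<open>u n\<close> vanished, \<open>u_v_relation_P\<close> would force
  \<open>v n\<close> to vanish as well.\<close>

lemma u_nonzero:
  assumes "t * refl (Suc n) + (of_nat n + \<nu>) * refl n \<noteq> 0"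
  shows "u n \<noteq> 0"
  using u_v_relation_P[of n] u_v_not_both_0[of n] assms by auto

section \<open>Solution of the Hamiltonian recurrence\<close>

context
  fixes x y :: "nat \<Rightarrow> 'a"
  assumes t: "t \<noteq> 0"
    and refl_bar: "refl_bar n \<noteq> 0"
    and refl_comb: "t * refl (Suc n) + (of_nat n + \<nu>) * refl n \<noteq> 0"
    and x_0: "x 0 = t + \<mu> / 2 - t * refl 1"
    and y_0: "y 0 = 1"
    and y_nonzero: "y n \<noteq> 0"
    and y_neq_1: "1 - y (Suc n) \<noteq> 0"
    and denom: "(x n)^2 - \<mu>^2 / 4 \<noteq> 0"
    and x_rec: "x (Suc n) + x n = t / y (Suc n) - of_nat (Suc n) / (1 - y (Suc n))"
    and y_rec: "y n * y (Suc n) = t * (x n + of_nat n + 1 + \<nu> + \<mu> / 2) / ((x n)^2 - \<mu>^2 / 4)"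
begin

text \<open>Dividing \<open>u_v_relation_P\<close> by \<open>u n\<close> eliminates the values at -1
  in favour of \<open>y n\<close>.\<close>

lemma y_refl_relation:
  assumes "y n = v n / (refl_bar n * u n)"
  shows "y n * (refl_bar n * (t * refl (Suc n) + (of_nat n + \<nu>) * refl n))
    = \<nu> + t * refl (Suc n) * refl_bar n"
proof -
  have "v n = y n * refl_bar n * u n"
    using assms refl_bar[of n] u_nonzero[OF refl_comb[of n]] by simp
  then have "u n * (\<nu> + t * refl (Suc n) * refl_bar n)
      = u n * (y n * (refl_bar n * (t * refl (Suc n) + (of_nat n + \<nu>) * refl n)))"
    using u_v_relation_P[of n] by (simp add: algebra_simps)
  then show ?thesis using u_nonzero[OF refl_comb[of n]] by simp
qed

text \<open>In the induction step, the Szego step and \<open>u_v_relation_Q\<close> factor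
  everything in the product recurrence into values at -1, which yields the next \<open>y\<close>.
  Then \<open>u_v_relation_P\<close> at the next index evaluates the fraction in the sum recurrence,
  which yields the next \<open>x\<close>.\<close>

lemma x_y_eq:
  "y n = v n / (refl_bar n * u n) \<and> x n = t / y n + \<mu> / 2 - t * refl (Suc n) * refl_bar n"
proof (induction n)
  case 0
  show ?case by (simp add: u_0 v_0 refl_bar_0 x_0 y_0)
next
  case (Suc n)
  define R B R1 B1 m c where defs: "R = refl n" "B = refl_bar n" "R1 = refl (Suc n)"
    "B1 = refl_bar (Suc n)" "m = x n - \<mu> / 2" "c = of_nat n + 1 + \<nu>"
  have u: "u n \<noteq> 0" "u (Suc n) \<noteq> 0" using u_nonzero[OF refl_comb] by blast+
  have B: "B \<noteq> 0" "B1 \<noteq> 0" by (simp_all add: defs refl_bar)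
  from Suc.IH have y: "y n = v n / (B * u n)" and x: "x n = t / y n + \<mu> / 2 - t * R1 * B"
    by (simp_all add: defs)
  have v: "v n \<noteq> 0" using y_nonzero[of n] y by auto
  have u1: "u (Suc n) = - u n + R1 * v n" and v1: "v (Suc n) = v n - B1 * u n"
    by (simp_all add: u_Suc v_Suc defs)
  have E2: "(\<mu> - t * R1 * B) * v n = - (t * B + c * B1) * u n"
    using u_v_relation_Q[of n] by (simp add: defs)
  have xm: "x n - \<mu> / 2 = - t * B * u (Suc n) / v n"
    using v u B by (simp add: x y u1 field_simps)
  have "(x n + \<mu> / 2) * v n = t * (v n / y n) + (\<mu> - t * R1 * B) * v n"
    by (simp add: x algebra_simps)
  also have "v n / y n = B * u n" using v u B by (simp add: y)
  finally have "(x n + \<mu> / 2) * v n = - c * B1 * u n" unfolding E2 by (simp add: algebra_simps)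
  then have xp: "x n + \<mu> / 2 = - c * B1 * u n / v n"
    using v by (simp add: field_simps)
  have prod: "(x n)^2 - \<mu>^2 / 4 = (x n - \<mu> / 2) * (x n + \<mu> / 2)"
    by (simp add: power2_eq_square field_simps)
  \<comment> \<open>Otherwise the second factor of the denominator of the product recurrence would
    vanish.\<close>
  have c: "c \<noteq> 0" using denom[of n] xp by (auto simp: prod)
  have num: "x n + of_nat n + 1 + \<nu> + \<mu> / 2 = c * v (Suc n) / v n"
  proof -
    have "x n + of_nat n + 1 + \<nu> + \<mu> / 2 = c + (x n + \<mu> / 2)" by (simp add: defs)
    also have "\<dots> = c * v (Suc n) / v n" unfolding xp v1 using v by (simp add: field_simps)
    finally show ?thesis .
  qed
  have "y n * y (Suc n) = t * (c * v (Suc n) / v n) / ((- t * B * u (Suc n) / v n) * (- c * B1 * u n / v n))"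
    using y_rec[of n] unfolding num prod xm xp .
  also have "\<dots> = y n * (v (Suc n) / (B1 * u (Suc n)))"
    unfolding y using t c v u B by (simp add: field_simps)
  finally have y1: "y (Suc n) = v (Suc n) / (B1 * u (Suc n))"
    using mult_left_cancel[OF y_nonzero[of n]] by blast
  define s where "s = t * refl (Suc (Suc n)) * B1"
  have s: "s * (1 - y (Suc n)) = c * R1 * B1 * y (Suc n) - \<nu>"
    using y_refl_relation[of "Suc n"] y1 by (simp add: defs s_def algebra_simps)
  \<comment> \<open>This consequence of the Szego step combines the two terms carrying the factor
    \<open>c\<close> below, leaving \<open>c - \<nu>\<close>, which is the integer
    \<open>Suc n\<close>.\<close>
  have key: "(1 - y (Suc n)) * (B1 * u n / v n) + R1 * B1 * y (Suc n) = 1"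
  proof -
    have "(1 - y (Suc n)) * (B1 * u n) + R1 * B1 * y (Suc n) * v n
        = B1 * u n + y (Suc n) * (B1 * u (Suc n))"
      by (simp add: u1 algebra_simps)
    also have "y (Suc n) * (B1 * u (Suc n)) = v (Suc n)" using u B by (simp add: y1)
    finally show ?thesis using v by (simp add: v1 field_simps)
  qed
  have "(c * (B1 * u n / v n) + s) * (1 - y (Suc n))
      = c * ((1 - y (Suc n)) * (B1 * u n / v n) + R1 * B1 * y (Suc n)) - \<nu>"
    using s by (simp add: algebra_simps)
  also have "\<dots> = of_nat (Suc n)" unfolding key by (simp add: defs)
  finally have cs: "of_nat (Suc n) / (1 - y (Suc n)) = c * (B1 * u n / v n) + s"
    using y_neq_1[of n] by (simp add: nonzero_divide_eq_eq)
  have xn: "x n = - (c * (B1 * u n / v n)) - \<mu> / 2"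
    using xp by (simp add: algebra_simps)
  have "x (Suc n) = t / y (Suc n) - of_nat (Suc n) / (1 - y (Suc n)) - x n"
    using x_rec[of n] by (simp only: eq_diff_eq)
  also have "\<dots> = t / y (Suc n) + \<mu> / 2 - s"
    unfolding cs xn by simp
  finally have "x (Suc n) = t / y (Suc n) + \<mu> / 2 - s" .
  with y1 show ?case by (simp add: s_def defs)
qed

text \<open>The last two identities restate \<open>x_y_eq\<close> and
  \<open>y_refl_relation\<close>. The first two come from eliminating between them, the third from
  \<open>u_v_relation_Q\<close> at index \<open>n - 1\<close>, which involves the preceding barred
  coefficient.\<close>

lemma x_y_refl_identities:
  assumes refl: "\<And>n. refl n \<noteq> 0"
  shows "(1 / y n - 1) * (x n - t / y n - \<nu> - \<mu> / 2) + of_nat n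
      = (of_nat n + \<nu>) * (1 - refl n * refl_bar n)" (is ?A)
    and "(x n - t / y n - \<mu> / 2) * (1 - y n) - \<nu> \<noteq> 0 \<Longrightarrow>
      (x n - t / y n - \<nu> - \<mu> / 2)
        * (1 + (of_nat n + \<nu>) / ((x n - t / y n - \<mu> / 2) * (1 - y n) - \<nu>)) - of_nat n
      = t * (refl (Suc n) / refl n) * (1 - refl n * refl_bar n)" (is "_ \<Longrightarrow> ?B")
    and "n \<ge> 1 \<Longrightarrow> (1 - y n) * (x n - t / y n + \<mu> / 2) + of_nat n
      = - t * (refl_bar (n - 1) / refl_bar n) * (1 - refl n * refl_bar n)" (is "_ \<Longrightarrow> ?C")
    and "y n = (\<nu> + t * refl (Suc n) * refl_bar n)
      / (refl_bar n * (t * refl (Suc n) + (of_nat n + \<nu>) * refl n))" (is ?D)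
    and "x n - t / y n - \<mu> / 2 = - t * refl (Suc n) * refl_bar n" (is ?E)
proof -
  define R B s N where defs: "R = refl n" "B = refl_bar n" "s = t * refl (Suc n) * refl_bar n"
    "N = (of_nat n :: 'a)"
  have R: "R \<noteq> 0" and B: "B \<noteq> 0" by (simp_all add: defs refl refl_bar)
  have y: "y n = v n / (B * u n)" and x: "x n = t / y n + \<mu> / 2 - s"
    using x_y_eq[of n] by (simp_all add: defs)
  have u: "u n \<noteq> 0" using u_nonzero[OF refl_comb] by blast
  have y0: "y n \<noteq> 0" by (rule y_nonzero)
  have s: "s * (1 - y n) = (N + \<nu>) * R * B * y n - \<nu>"
    using y_refl_relation[of n] y by (simp add: defs algebra_simps)
  show ?E by (simp add: x defs)
  show ?D
    using y_refl_relation[of n] y B refl_comb[of n] by (simp add: defs nonzero_eq_divide_eq)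
  have "(s + \<nu>) * (1 - y n) = s * (1 - y n) + \<nu> * (1 - y n)"
    by (rule distrib_right)
  also have "\<dots> = ((N + \<nu>) * R * B - \<nu>) * y n"
    unfolding s by (simp add: algebra_simps)
  finally have "(s + \<nu>) * (1 - y n) = ((N + \<nu>) * R * B - \<nu>) * y n" .
  moreover have "1 / y n - 1 = (1 - y n) / y n" using y0 by (simp add: diff_divide_distrib)
  ultimately have sy: "(s + \<nu>) * (1 / y n - 1) = (N + \<nu>) * R * B - \<nu>"
    using y0 by simp
  have xs: "x n - t / y n - \<nu> - \<mu> / 2 = - (s + \<nu>)" "x n - t / y n - \<mu> / 2 = - s"
    "x n - t / y n + \<mu> / 2 = \<mu> - s"
    by (simp_all add: x)
  have "a * (- b) + N = N - b * a" for a b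
    by (simp add: mult.commute)
  then have "(1 / y n - 1) * (- (s + \<nu>)) + N = N - (s + \<nu>) * (1 / y n - 1)" .
  also have "\<dots> = (N + \<nu>) * (1 - R * B)"
    unfolding sy by (simp add: algebra_simps)
  finally have "(1 / y n - 1) * (- (s + \<nu>)) + N = (N + \<nu>) * (1 - R * B)" .
  then show ?A unfolding xs by (simp only: defs)
  show ?B if nz: "(x n - t / y n - \<mu> / 2) * (1 - y n) - \<nu> \<noteq> 0"
  proof -
    \<comment> \<open>The denominator collapses to a monomial, so its nonvanishing also yields that
      of \<open>N + \<nu>\<close>, and that factor cancels.\<close>
    have d: "- s * (1 - y n) - \<nu> = - ((N + \<nu>) * R * B * y n)"
      using s by (simp add: algebra_simps)
    have Nnu: "N + \<nu> \<noteq> 0" using nz unfolding xs d by auto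
    have "(N + \<nu>) / (- ((N + \<nu>) * R * B * y n)) = - (1 / (R * B * y n))"
      using Nnu by (simp add: mult.assoc)
    then have "- (s + \<nu>) * (1 + (N + \<nu>) / (- ((N + \<nu>) * R * B * y n))) - N
        = - (s + \<nu>) * (1 - 1 / (R * B * y n)) - N"
      by simp
    \<comment> \<open>The split isolates the product evaluated by \<open>sy\<close>.\<close>
    also have "\<dots> = (s + \<nu>) * (1 / y n - 1) / (R * B) + (s + \<nu>) * (1 - R * B) / (R * B) - N"
      using R B y0 by (simp add: field_simps)
    also have "\<dots> = s / (R * B) * (1 - R * B)"
      unfolding sy using R B by (simp add: field_simps)
    also have "s / (R * B) = t * (refl (Suc n) / R)" using R B by (simp add: defs)
    finally show ?B unfolding xs d by (simp only: defs)
  qed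
  show ?C if "n \<ge> 1"
  proof -
    obtain k where k: "n = Suc k" using \<open>n \<ge> 1\<close> by (cases n) auto
    define B' where "B' = refl_bar k"
    define T where "T = t * (B' / B) * (1 - R * B)"
    have E2: "(\<mu> - t * R * B') * v k = - (t * B' + (N + \<nu>) * B) * u k"
      using u_v_relation_Q[of k] by (simp add: defs k B'_def algebra_simps)
    have uk: "u n = - u k + R * v k" and vk: "v n = v k - B * u k"
      by (simp_all add: u_Suc v_Suc defs k)
    \<comment> \<open>Inverting the Szego step: \<open>v n - B * u n\<close> and
      \<open>R * v n - u n\<close> are \<open>1 - R * B\<close> times \<open>v k\<close> and
      \<open>u k\<close>, so the relation at \<open>k\<close> is carried over to
      \<open>n\<close>.\<close>
    have "(\<mu> * (v n - B * u n) - t * B' * (1 - R * B) * u n + (N + \<nu>) * B * (R * v n - u n))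
        = (1 - R * B) * ((\<mu> - t * R * B') * v k + (t * B' + (N + \<nu>) * B) * u k)"
      unfolding uk vk by (simp add: algebra_simps)
    also have "\<dots> = 0" unfolding E2 by (simp add: algebra_simps)
    also have "v n = B * u n * y n" using y u B by simp
    also have "\<mu> * (B * u n * y n - B * u n) - t * B' * (1 - R * B) * u n
          + (N + \<nu>) * B * (R * (B * u n * y n) - u n)
        = B * u n * (\<mu> * (y n - 1) - t * (B' / B) * (1 - R * B) + (N + \<nu>) * (R * B * y n - 1))"
      using B by (simp add: field_simps)
    finally have "\<mu> * (y n - 1) - t * (B' / B) * (1 - R * B) + (N + \<nu>) * (R * B * y n - 1) = 0"
      using u B by simp
    then have "\<mu> * (y n - 1) - T + (N + \<nu>) * (R * B * y n - 1) = 0" unfolding T_def .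
    then have "- T = \<mu> * (1 - y n) - (N + \<nu>) * (R * B * y n - 1)"
      by (simp add: algebra_simps)
    also have "\<dots> = \<mu> * (1 - y n) - s * (1 - y n) + N"
      unfolding s by (simp add: algebra_simps)
    finally have "(1 - y n) * (\<mu> - s) + N = - t * (B' / B) * (1 - R * B)"
      unfolding T_def by (simp add: algebra_simps)
    then show ?C unfolding xs by (simp add: defs k B'_def)
  qed
qed

end

end

section \<open>Fourier coefficients of the weight\<close>

text \<open>The base vanishes at both endpoints; continuity there rests on the positive real part of
  the exponent.\<close>

lemma continuous_on_cos_powr:
  assumes "Re b > 0"
  shows "continuous_on {-pi..pi} (\<lambda>\<theta>. complex_of_real (2 * cos (\<theta> / 2)) powr b)"
proof (rule continuous_on_powr_complex)
  have "cos (\<theta> / 2) \<ge> 0" if "\<theta> \<in> {-pi..pi}" for \<theta> using that by (intro cos_ge_zero) auto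
  then show "{-pi..pi} \<subseteq> {\<theta>. Re (complex_of_real (2 * cos (\<theta> / 2))) \<ge> 0
      \<or> Im (complex_of_real (2 * cos (\<theta> / 2))) \<noteq> 0}" by auto
qed (use assms in \<open>auto intro!: continuous_intros\<close>)

lemma cos_half_pos: "\<theta> \<in> {-pi<..<pi} \<Longrightarrow> cos (\<theta> / 2) > 0"
  by (intro cos_gt_zero_pi) auto

lemma has_vector_derivative_cos_powr:
  assumes "\<theta> \<in> {-pi<..<pi}"
  shows "((\<lambda>\<theta>. complex_of_real (2 * cos (\<theta> / 2)) powr (a + 1)) has_vector_derivative
    - (a + 1) * complex_of_real (2 * cos (\<theta> / 2)) powr a * of_real (sin (\<theta> / 2))) (at \<theta>)"
proof -
  let ?C = "\<lambda>\<theta>. complex_of_real (2 * cos (\<theta> / 2))"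
  have "((\<lambda>\<theta>. 2 * cos (\<theta> / 2)) has_real_derivative - sin (\<theta> / 2)) (at \<theta>)"
    by (auto intro!: derivative_eq_intros)
  then have 1: "(?C has_vector_derivative of_real (- sin (\<theta> / 2))) (at \<theta>)"
    by (rule has_vector_derivative_of_real)
  have "?C \<theta> \<notin> \<real>\<^sub>\<le>\<^sub>0"
    using cos_half_pos[OF assms] by (auto simp: complex_nonpos_Reals_iff)
  from has_field_derivative_powr[OF this, of "a + 1"]
  have "((\<lambda>z. z powr (a + 1)) has_field_derivative (a + 1) * ?C \<theta> powr a) (at (?C \<theta>))" by simp
  from field_vector_diff_chain_at[OF 1 this] show ?thesis
    by (simp add: o_def algebra_simps)
qed

text \<open>Up to a continuous function, the integrand is a multiple of the derivative of
  \<open>sin (\<theta> / 2) * (2 * cos (\<theta> / 2)) powr (a + 1) * h \<theta>\<close>, which is continuous up to the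
  endpoints.\<close>

lemma cos_powr_mult_integrable:
  fixes h h' :: "real \<Rightarrow> complex"
  assumes a: "Re a > -1"
    and h: "\<And>\<theta>. (h has_vector_derivative h' \<theta>) (at \<theta>)" and h': "continuous_on UNIV h'"
  shows "(\<lambda>\<theta>. complex_of_real (2 * cos (\<theta> / 2)) powr a * h \<theta>) integrable_on {-pi..pi}"
proof -
  let ?C = "\<lambda>\<theta>. complex_of_real (2 * cos (\<theta> / 2))"
  \<comment> \<open>The sine factor in \<open>F\<close> makes the derivative contain the square of
    the sine, that is, 1 minus a quarter of the squared base; the 1 recovers the power with exponent
    \<open>a\<close>. The constant \<open>(a + 2) / 4\<close> collects \<open>(a + 1) / 4\<close>
    from this replacement and 1/4 from differentiating the sine.\<close>
  define G where "G \<theta> = (a + 2) / 4 * ?C \<theta> powr (a + 2) * h \<theta>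
    + of_real (sin (\<theta> / 2)) * ?C \<theta> powr (a + 1) * h' \<theta>" for \<theta>
  define F where "F \<theta> = of_real (sin (\<theta> / 2)) * (?C \<theta> powr (a + 1) * h \<theta>)" for \<theta>
  have a1: "a + 1 \<noteq> 0" using a by (auto simp: complex_eq_iff)
  have conth: "continuous_on A h" for A
    using h by (meson continuous_at_imp_continuous_on has_vector_derivative_continuous)
  have conth': "continuous_on A h'" for A
    using h' by (rule continuous_on_subset) auto
  have contC: "continuous_on {-pi..pi} (\<lambda>\<theta>. ?C \<theta> powr (a + 1))"
    "continuous_on {-pi..pi} (\<lambda>\<theta>. ?C \<theta> powr (a + 2))"
    by (rule continuous_on_cos_powr; use a in simp)+
  have contS: "continuous_on A (\<lambda>\<theta>. complex_of_real (sin (\<theta> / 2)))" for A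
    by (intro continuous_intros) auto
  have "continuous_on {-pi..pi} G"
    unfolding G_def
    by (intro continuous_on_add continuous_on_mult continuous_on_const contC contS conth conth')
  then have G: "G integrable_on {-pi..pi}" by (rule integrable_continuous_real)
  have "((\<lambda>\<theta>. G \<theta> - (a + 1) * (?C \<theta> powr a * h \<theta>)) has_integral F pi - F (-pi)) {-pi..pi}"
  proof (rule fundamental_theorem_of_calculus_interior)
    show "continuous_on {-pi..pi} F"
      unfolding F_def by (intro continuous_on_mult contC contS conth)
    fix \<theta> assume \<theta>: "\<theta> \<in> {-pi<..<pi}"
    have C: "?C \<theta> \<noteq> 0" using cos_half_pos[OF \<theta>] by simp
    have "((\<lambda>\<theta>. sin (\<theta> / 2)) has_real_derivative cos (\<theta> / 2) / 2) (at \<theta>)"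
      by (auto intro!: derivative_eq_intros)
    then have S: "((\<lambda>\<theta>. complex_of_real (sin (\<theta> / 2))) has_vector_derivative
        of_real (cos (\<theta> / 2) / 2)) (at \<theta>)"
      by (rule has_vector_derivative_of_real)
    have sq: "complex_of_real (sin (\<theta> / 2)) * of_real (sin (\<theta> / 2)) = 1 - (?C \<theta>)\<^sup>2 / 4"
    proof -
      have "sin (\<theta> / 2) * sin (\<theta> / 2) = 1 - (2 * cos (\<theta> / 2))\<^sup>2 / 4"
        using sin_squared_eq[of "\<theta> / 2"] by (simp add: power2_eq_square)
      from arg_cong[OF this, of complex_of_real] show ?thesis by simp
    qed
    have p1: "?C \<theta> powr (a + 1) = ?C \<theta> powr a * ?C \<theta>"
      and p2: "?C \<theta> powr (a + 2) = ?C \<theta> powr a * (?C \<theta>)\<^sup>2"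
      using C by (simp_all add: powr_add)
    have "G \<theta> - (a + 1) * (?C \<theta> powr a * h \<theta>) = of_real (sin (\<theta> / 2))
          * (?C \<theta> powr (a + 1) * h' \<theta>
             + (- (a + 1) * ?C \<theta> powr a * of_real (sin (\<theta> / 2))) * h \<theta>)
        + of_real (cos (\<theta> / 2) / 2) * (?C \<theta> powr (a + 1) * h \<theta>)" (is "_ = ?D")
    proof -
      have "?D = of_real (sin (\<theta> / 2)) * ?C \<theta> powr (a + 1) * h' \<theta>
          - (a + 1) * ?C \<theta> powr a * h \<theta> * (of_real (sin (\<theta> / 2)) * of_real (sin (\<theta> / 2)))
          + ?C \<theta> / 4 * (?C \<theta> powr (a + 1) * h \<theta>)"
        by (simp add: algebra_simps)
      also have "\<dots> = G \<theta> - (a + 1) * (?C \<theta> powr a * h \<theta>)"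
        unfolding sq G_def p1 p2 by (simp add: field_simps power2_eq_square)
      finally show ?thesis by simp
    qed
    moreover have "(F has_vector_derivative ?D) (at \<theta>)"
      unfolding F_def
      by (intro has_vector_derivative_mult S h has_vector_derivative_cos_powr \<theta>)
    ultimately show "(F has_vector_derivative G \<theta> - (a + 1) * (?C \<theta> powr a * h \<theta>)) (at \<theta>)"
      by simp
  qed simp
  then have "(\<lambda>\<theta>. G \<theta> - (a + 1) * (?C \<theta> powr a * h \<theta>)) integrable_on {-pi..pi}"
    by (rule has_integral_integrable)
  from integrable_diff[OF G this]
  have "(\<lambda>\<theta>. (a + 1) * (?C \<theta> powr a * h \<theta>)) integrable_on {-pi..pi}" by simp
  with a1 show ?thesis by simp
qed

text \<open>The smooth factor of the integrand. The Fourier index is absorbed into the complex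
  exponent \<open>c\<close>, which also admits the half-integer shifts caused by half
  angles.\<close>

definition phase :: "complex \<Rightarrow> complex \<Rightarrow> real \<Rightarrow> complex" where
  "phase c t \<theta> = exp (\<i> * of_real \<theta> * c + t * exp (\<i> * of_real \<theta>))"

lemma has_vector_derivative_phase:
  "(phase c t has_vector_derivative (\<i> * (c + t * exp (\<i> * of_real \<theta>)) * phase c t \<theta>)) (at \<theta>)"
  unfolding phase_def
  by (rule has_vector_derivative_real_field)
    (auto intro!: derivative_eq_intros simp: algebra_simps)

lemma continuous_phase: "continuous_on A (phase c t)"
  unfolding phase_def by (intro continuous_intros)

lemma cos_powr_mult_phase_integrable:
  assumes "Re a > -1"
  shows "(\<lambda>\<theta>. complex_of_real (2 * cos (\<theta> / 2)) powr a * phase c t \<theta>) integrable_on {-pi..pi}"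
  by (rule cos_powr_mult_integrable[OF assms has_vector_derivative_phase])
    (intro continuous_intros continuous_phase)

lemma one_plus_exp_i:
  "1 + exp (\<i> * of_real \<theta>) = of_real (2 * cos (\<theta> / 2)) * exp (\<i> * of_real (\<theta> / 2))"
proof -
  have "\<theta> = 2 * (\<theta> / 2)" by simp
  then have "cos \<theta> = 2 * (cos (\<theta> / 2))\<^sup>2 - 1" "sin \<theta> = 2 * sin (\<theta> / 2) * cos (\<theta> / 2)"
    by (metis cos_double_cos) (metis \<open>\<theta> = 2 * (\<theta> / 2)\<close> sin_double)
  then show ?thesis
    by (simp add: complex_eq_iff Re_exp Im_exp power2_eq_square)
qed

lemma weight_integrand_eq:
  assumes "\<theta> \<in> {-pi..pi}"
  shows "weight \<mu> \<nu> t \<theta> * exp (- \<i> * of_int k * of_real \<theta>)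
    = complex_of_real (2 * cos (\<theta> / 2)) powr (\<mu> + \<nu>) * phase ((\<mu> - \<nu>) / 2 - of_int k) t \<theta>"
proof -
  have "cos (\<theta> / 2) \<ge> 0" using assms by (intro cos_ge_zero) auto
  then have "cmod (1 + exp (\<i> * of_real \<theta>)) = 2 * cos (\<theta> / 2)"
    unfolding one_plus_exp_i norm_mult by (simp add: norm_exp_eq_Re)
  then show ?thesis
    by (simp add: weight_def phase_def exp_add [symmetric] algebra_simps)
qed

lemma weight_coeff_has_integral:
  assumes "Re (\<mu> + \<nu>) > -1"
  shows "((\<lambda>\<theta>. complex_of_real (2 * cos (\<theta> / 2)) powr (\<mu> + \<nu>)
      * phase ((\<mu> - \<nu>) / 2 - of_int k) t \<theta>) has_integral 2 * of_real pi * weight_coeff \<mu> \<nu> t k)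
    {-pi..pi}"
proof -
  have "integral {-pi..pi} (\<lambda>\<theta>. weight \<mu> \<nu> t \<theta> * exp (- \<i> * of_int k * of_real \<theta>))
      = integral {-pi..pi} (\<lambda>\<theta>. complex_of_real (2 * cos (\<theta> / 2)) powr (\<mu> + \<nu>)
          * phase ((\<mu> - \<nu>) / 2 - of_int k) t \<theta>)"
    by (rule integral_cong) (rule weight_integrand_eq)
  then show ?thesis
    using integrable_integral[OF cos_powr_mult_phase_integrable[OF assms]]
    by (simp add: weight_coeff_def)
qed

text \<open>Integration of the derivative of \<open>(1 + z) * z ^ (- k) * weight\<close>, which vanishes at
  the endpoints.\<close>

lemma weight_coeff_recurrence:
  assumes "Re (\<mu> + \<nu>) > -1"
  shows "(of_int k + \<nu>) * weight_coeff \<mu> \<nu> t k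
    + (of_int k - 1 - \<mu> - t) * weight_coeff \<mu> \<nu> t (k - 1) - t * weight_coeff \<mu> \<nu> t (k - 2) = 0"
proof -
  let ?C = "\<lambda>\<theta>. complex_of_real (2 * cos (\<theta> / 2))"
  define c where "c = (\<mu> - \<nu>) / 2 - of_int k"
  \<comment> \<open>This is (1 + z) z^(-k) times the weight; the shift by 1/2 comes from 1 + z being
    \<open>?C \<theta>\<close> times the exponential of half the angle.\<close>
  define F where "F \<theta> = ?C \<theta> powr (\<mu> + \<nu> + 1) * phase (c + 1 / 2) t \<theta>" for \<theta>
  define f where "f j \<theta> = ?C \<theta> powr (\<mu> + \<nu>) * phase ((\<mu> - \<nu>) / 2 - of_int j) t \<theta>" for j \<theta>
  define D where "D \<theta> = (of_int k + \<nu>) * f k \<theta> + (of_int k - 1 - \<mu> - t) * f (k - 1) \<theta>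
    - t * f (k - 2) \<theta>" for \<theta>
  have "((\<lambda>\<theta>. - \<i> * D \<theta>) has_integral F pi - F (-pi)) {-pi..pi}"
  proof (rule fundamental_theorem_of_calculus_interior)
    show "continuous_on {-pi..pi} F"
      unfolding F_def
      by (intro continuous_on_mult continuous_phase continuous_on_cos_powr) (use assms in simp)
    fix \<theta> assume \<theta>: "\<theta> \<in> {-pi<..<pi}"
    define E where "E = exp (\<i> * complex_of_real (\<theta> / 2))"
    define W where "W = ?C \<theta> powr (\<mu> + \<nu>) * phase c t \<theta>"
    have E: "E \<noteq> 0" by (simp add: E_def)
    have C: "?C \<theta> \<noteq> 0" using cos_half_pos[OF \<theta>] by simp
    have E2: "exp (\<i> * complex_of_real \<theta>) = E\<^sup>2"
      by (simp add: E_def exp_double [symmetric])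
    \<comment> \<open>With \<open>E\<close> as variable, the derivative becomes a polynomial
      identity in \<open>E\<close>.\<close>
    have CE: "?C \<theta> = E + 1 / E"
      and SE: "complex_of_real (sin (\<theta> / 2)) = (E - 1 / E) / (2 * \<i>)"
    proof -
      have "1 / E = exp (- (\<i> * complex_of_real (\<theta> / 2)))" by (simp add: E_def exp_minus field_simps)
      then show "?C \<theta> = E + 1 / E" "complex_of_real (sin (\<theta> / 2)) = (E - 1 / E) / (2 * \<i>)"
        by (simp_all add: E_def sin_exp_eq cos_exp_eq sin_of_real [symmetric] cos_of_real [symmetric])
    qed
    have ph: "phase (c + 1 / 2) t \<theta> = E * phase c t \<theta>"
      "f k \<theta> = W" "f (k - 1) \<theta> = E\<^sup>2 * W" "f (k - 2) \<theta> = E\<^sup>2 * (E\<^sup>2 * W)"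
      by (simp_all add: f_def W_def phase_def c_def E_def exp_add [symmetric] exp_double [symmetric]
          algebra_simps)
    have "(F has_vector_derivative
        ?C \<theta> powr (\<mu> + \<nu> + 1) * (\<i> * (c + 1 / 2 + t * exp (\<i> * of_real \<theta>)) * phase (c + 1 / 2) t \<theta>)
        + (- (\<mu> + \<nu> + 1) * ?C \<theta> powr (\<mu> + \<nu>) * of_real (sin (\<theta> / 2))) * phase (c + 1 / 2) t \<theta>)
        (at \<theta>)" (is "(F has_vector_derivative ?F') _")
      unfolding F_def
      by (intro has_vector_derivative_mult has_vector_derivative_phase
          has_vector_derivative_cos_powr \<theta>)
    moreover have "?F' = - \<i> * D \<theta>"
    proof -
      have p: "?C \<theta> powr (\<mu> + \<nu> + 1) = ?C \<theta> powr (\<mu> + \<nu>) * ?C \<theta>"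
        using C by (simp add: powr_add)
      have "?F' = W * E * (?C \<theta> * (\<i> * (c + 1 / 2 + t * E\<^sup>2))
          - (\<mu> + \<nu> + 1) * of_real (sin (\<theta> / 2)))"
        unfolding p ph E2 W_def by (simp add: algebra_simps)
      also have "\<dots> = \<i> * W * ((E\<^sup>2 + 1) * (c + 1 / 2 + t * E\<^sup>2) + (\<mu> + \<nu> + 1) / 2 * (E\<^sup>2 - 1))"
        unfolding CE SE using E by (simp add: field_simps power2_eq_square)
      also have "\<dots> = - \<i> * D \<theta>"
        unfolding D_def ph c_def by (simp add: field_simps power2_eq_square)
      finally show ?thesis .
    qed
    ultimately show "(F has_vector_derivative - \<i> * D \<theta>) (at \<theta>)" by simp
  qed simp
  \<comment> \<open>The base is 0 at both endpoints, and \<open>powr\<close> with base 0 is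
    0.\<close>
  moreover have "F pi = 0" "F (-pi) = 0" by (simp_all add: F_def)
  ultimately have "((\<lambda>\<theta>. - \<i> * D \<theta>) has_integral 0) {-pi..pi}" by simp
  from has_integral_mult_right[OF this, of \<i>]
  have 0: "(D has_integral 0) {-pi..pi}" by (simp add: mult.assoc [symmetric])
  have f: "(f j has_integral 2 * of_real pi * weight_coeff \<mu> \<nu> t j) {-pi..pi}" for j
    unfolding f_def by (rule weight_coeff_has_integral[OF assms])
  have "(D has_integral ((of_int k + \<nu>) * (2 * of_real pi * weight_coeff \<mu> \<nu> t k)
      + (of_int k - 1 - \<mu> - t) * (2 * of_real pi * weight_coeff \<mu> \<nu> t (k - 1))
      - t * (2 * of_real pi * weight_coeff \<mu> \<nu> t (k - 2)))) {-pi..pi}" (is "(_ has_integral ?I) _")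
    unfolding D_def by (intro has_integral_add has_integral_diff has_integral_mult_right f)
  with 0 have "?I = 0" by (rule has_integral_unique [symmetric])
  moreover have "?I = 2 * of_real pi * ((of_int k + \<nu>) * weight_coeff \<mu> \<nu> t k
    + (of_int k - 1 - \<mu> - t) * weight_coeff \<mu> \<nu> t (k - 1) - t * weight_coeff \<mu> \<nu> t (k - 2))"
    by (simp add: algebra_simps)
  ultimately show ?thesis by simp
qed

section \<open>Power series in t and Kummer's function\<close>

text \<open>Termwise integration of the exponential series of t z: each factor z lowers the Fourier
  index by one. Dominated convergence applies because the partial sums of the series are bounded by
  exp |t| on the circle.\<close>

lemma weight_coeff_sums:
  assumes "Re (\<mu> + \<nu>) > -1"
  shows "(\<lambda>n. t ^ n / fact n * weight_coeff \<mu> \<nu> 0 (k - int n)) sums weight_coeff \<mu> \<nu> t k"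
proof -
  let ?C = "\<lambda>\<theta>. complex_of_real (2 * cos (\<theta> / 2))"
  define b where "b = (\<mu> - \<nu>) / 2 - of_int k"
  define f where "f n \<theta> = ?C \<theta> powr (\<mu> + \<nu>) * phase ((\<mu> - \<nu>) / 2 - of_int (k - int n)) 0 \<theta>" for n \<theta>
  define S where "S N \<theta> = (\<Sum>n<N. t ^ n / fact n * f n \<theta>)" for N \<theta>
  define g where "g \<theta> = ?C \<theta> powr (\<mu> + \<nu>) * phase b t \<theta>" for \<theta>
  \<comment> \<open>\<open>phase 0 0\<close> is constantly 1; this form reduces the integrability of
    the real bound to the complex statement.\<close>
  define H where "H \<theta> = Re (?C \<theta> powr of_real (Re (\<mu> + \<nu>)) * phase 0 0 \<theta>)
      * (exp (pi * cmod b) * exp (cmod t))" for \<theta>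
  have f_eq: "t ^ n / fact n * f n \<theta> = ?C \<theta> powr (\<mu> + \<nu>) * exp (\<i> * of_real \<theta> * b)
      * ((t * exp (\<i> * of_real \<theta>)) ^ n / fact n)" for n \<theta>
    by (simp add: f_def phase_def b_def power_mult_distrib exp_of_nat_mult [symmetric]
        exp_add [symmetric] algebra_simps)
  have S_int: "(S N has_integral (\<Sum>n<N. t ^ n / fact n
      * (2 * of_real pi * weight_coeff \<mu> \<nu> 0 (k - int n)))) {-pi..pi}" for N
    unfolding S_def f_def
    by (intro has_integral_sum has_integral_mult_right weight_coeff_has_integral assms) simp
  have "(\<lambda>N. integral {-pi..pi} (S N)) \<longlonglongrightarrow> integral {-pi..pi} g"
  proof (rule dominated_convergence(2))
    show "S N integrable_on {-pi..pi}" for N using S_int by (rule has_integral_integrable)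
    show "H integrable_on {-pi..pi}"
      unfolding H_def
      by (intro integrable_on_mult_left integrable_linear[OF _ bounded_linear_Re, unfolded o_def]
          cos_powr_mult_phase_integrable) (use assms in simp)
    show "(\<lambda>N. S N \<theta>) \<longlonglongrightarrow> g \<theta>" for \<theta>
    proof -
      have "(\<lambda>n. (t * exp (\<i> * of_real \<theta>)) ^ n / fact n) sums exp (t * exp (\<i> * of_real \<theta>))"
        using exp_converges[of "t * exp (\<i> * of_real \<theta>)"] by (simp add: scaleR_conv_of_real field_simps)
      from sums_mult[OF this, of "?C \<theta> powr (\<mu> + \<nu>) * exp (\<i> * of_real \<theta> * b)"]
      show ?thesis
        unfolding sums_def S_def f_eq g_def phase_def by (simp add: exp_add mult.assoc)
    qed
    show "norm (S N \<theta>) \<le> H \<theta>" if "\<theta> \<in> {-pi..pi}" for N \<theta>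
    proof -
      have cos: "cos (\<theta> / 2) \<ge> 0" using that by (intro cos_ge_zero) auto
      have "norm (S N \<theta>) = norm (?C \<theta> powr (\<mu> + \<nu>)) * norm (exp (\<i> * of_real \<theta> * b))
          * norm (\<Sum>n<N. (t * exp (\<i> * of_real \<theta>)) ^ n / fact n)"
        unfolding S_def f_eq by (simp only: sum_distrib_left [symmetric] norm_mult)
      also have "\<dots> \<le> (2 * cos (\<theta> / 2)) powr Re (\<mu> + \<nu>) * exp (pi * cmod b) * exp (cmod t)"
      proof (intro mult_mono)
        show "norm (?C \<theta> powr (\<mu> + \<nu>)) \<le> (2 * cos (\<theta> / 2)) powr Re (\<mu> + \<nu>)"
          using cos by (subst norm_powr_real_powr) auto
        have "Re (\<i> * of_real \<theta> * b) \<le> cmod (\<i> * of_real \<theta> * b)" by (rule complex_Re_le_cmod)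
        also have "\<dots> \<le> pi * cmod b"
          using that by (auto simp: norm_mult intro!: mult_right_mono)
        finally show "norm (exp (\<i> * of_real \<theta> * b)) \<le> exp (pi * cmod b)"
          by (simp add: norm_exp_eq_Re)
        have "norm (\<Sum>n<N. (t * exp (\<i> * of_real \<theta>)) ^ n / fact n) \<le> (\<Sum>n<N. cmod t ^ n / fact n)"
          by (rule sum_norm_le) (simp add: norm_divide norm_power norm_mult norm_exp_eq_Re)
        also have "\<dots> \<le> exp (cmod t)"
          using exp_converges[of "cmod t"]
          by (intro sum_le_suminf[THEN order_trans]) (auto simp: exp_def sums_iff field_simps)
        finally show "norm (\<Sum>n<N. (t * exp (\<i> * of_real \<theta>)) ^ n / fact n) \<le> exp (cmod t)" .
      qed auto
      also have "\<dots> = H \<theta>"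
      proof -
        have "?C \<theta> powr of_real (Re (\<mu> + \<nu>)) = of_real ((2 * cos (\<theta> / 2)) powr Re (\<mu> + \<nu>))"
          using cos by (intro powr_of_real) simp
        then show ?thesis unfolding H_def by (simp add: phase_def mult.assoc)
      qed
      finally show ?thesis .
    qed
  qed
  moreover have "integral {-pi..pi} g = 2 * of_real pi * weight_coeff \<mu> \<nu> t k"
    unfolding g_def b_def by (rule integral_unique[OF weight_coeff_has_integral[OF assms]])
  moreover have "integral {-pi..pi} (S N) = 2 * of_real pi
      * (\<Sum>n<N. t ^ n / fact n * weight_coeff \<mu> \<nu> 0 (k - int n))" for N
    using integral_unique[OF S_int[of N]] by (simp add: sum_distrib_left mult_ac)
  ultimately have "(\<lambda>N. 2 * of_real pi * (\<Sum>n<N. t ^ n / fact n * weight_coeff \<mu> \<nu> 0 (k - int n)))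
      \<longlonglongrightarrow> 2 * of_real pi * weight_coeff \<mu> \<nu> t k" by simp
  from tendsto_mult_left[OF this, of "1 / (2 * of_real pi)"] show ?thesis
    by (simp add: sums_def)
qed

text \<open>At t = 0 the three-term recurrence loses its last term and becomes a first-order
  recurrence, whose solution is a quotient of Pochhammer symbols.\<close>

lemma weight_coeff_0_neg:
  assumes "Re (\<mu> + \<nu>) > -1" and "\<mu> + 1 \<notin> \<int>\<^sub>\<le>\<^sub>0"
  shows "weight_coeff \<mu> \<nu> 0 (- int n)
    = (-1) ^ n * pochhammer (- \<nu>) n / pochhammer (\<mu> + 1) n * weight_coeff \<mu> \<nu> 0 0"
proof (induction n)
  case 0
  show ?case by simp
next
  case (Suc n)
  have nz: "\<mu> + 1 + of_nat n \<noteq> 0" using assms(2) plus_of_nat_eq_0_imp by blast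
  define d where "d = - \<nu> + of_nat n"
  have "(\<mu> + 1 + of_nat n) * weight_coeff \<mu> \<nu> 0 (- int (Suc n))
      = - d * weight_coeff \<mu> \<nu> 0 (- int n)"
  proof -
    have *: "- int (Suc n) = - int n - 1" by simp
    show ?thesis
      unfolding * d_def using weight_coeff_recurrence[OF assms(1), of "- int n" 0] by (simp add: algebra_simps)
  qed
  then have "weight_coeff \<mu> \<nu> 0 (- int (Suc n))
      = - d / (\<mu> + 1 + of_nat n) * weight_coeff \<mu> \<nu> 0 (- int n)"
    using nz by (metis nonzero_mult_div_cancel_left times_divide_eq_left)
  then show ?case
    unfolding Suc.IH pochhammer_Suc d_def [symmetric] by (simp add: mult_ac)
qed

text \<open>As functions of t, the coefficients of index 0 and -1 are the same constant multiple of
  Kummer's function at -t and of its derivative in t; the constant cancels in the quotient.\<close>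

lemma log_deriv_kummer:
  assumes re: "Re (\<mu> + \<nu>) > -1" and \<mu>: "\<mu> + 1 \<notin> \<int>\<^sub>\<le>\<^sub>0" and nz: "weight_coeff \<mu> \<nu> t 0 \<noteq> 0"
  shows "log_deriv (\<lambda>s. kummer (- \<nu>) (\<mu> + 1) (- s)) t
    = weight_coeff \<mu> \<nu> t (-1) / weight_coeff \<mu> \<nu> t 0"
proof -
  define F where "F = fps_hypergeo [- \<nu>] [\<mu> + 1] 1"
  define c where "c = weight_coeff \<mu> \<nu> 0 0"
  have coeffs: "s ^ n / fact n * weight_coeff \<mu> \<nu> 0 (- int n) = c * (fps_nth F n * (- s) ^ n)"
    for s n
    by (simp add: F_def c_def weight_coeff_0_neg[OF re \<mu>] power_minus[of s] mult_ac)
  have sums: "(\<lambda>n. c * (fps_nth F n * (- s) ^ n)) sums weight_coeff \<mu> \<nu> s 0" for s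
    using weight_coeff_sums[OF re, of s 0] unfolding diff_0 coeffs .
  have c: "c \<noteq> 0" using sums[of t] nz sums_unique2[OF _ sums_zero] by force
  \<comment> \<open>The expansion of the coefficient of index 0 converges for every value of t,
    which gives an infinite radius of convergence once the nonzero factor \<open>c\<close> is
    removed.\<close>
  have "summable (\<lambda>n. fps_nth F n * z ^ n)" for z
    using sums_summable[OF sums[of "- z"]] c by (simp add: summable_cmult_iff)
  then have conv: "fps_conv_radius F = \<infinity>"
    unfolding fps_conv_radius_def by (rule conv_radius_inftyI'')
  have kummer: "kummer (- \<nu>) (\<mu> + 1) = eval_fps F" by (simp add: kummer_def F_def fun_eq_iff)
  have w0: "weight_coeff \<mu> \<nu> t 0 = c * eval_fps F (- t)"
  proof (rule sums_unique2[OF sums])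
    show "(\<lambda>n. c * (fps_nth F n * (- t) ^ n)) sums (c * eval_fps F (- t))"
      by (intro sums_mult sums_eval_fps) (simp add: conv)
  qed
  have w1: "weight_coeff \<mu> \<nu> t (-1) = - c * eval_fps (fps_deriv F) (- t)"
  proof (rule sums_unique2)
    show "(\<lambda>n. - c * (fps_nth (fps_deriv F) n * (- t) ^ n)) sums (- c * eval_fps (fps_deriv F) (- t))"
      by (intro sums_mult sums_eval_fps) (use fps_conv_radius_deriv[of F] conv in auto)
    have "t ^ n / fact n * weight_coeff \<mu> \<nu> 0 (-1 - int n)
        = - c * (fps_nth (fps_deriv F) n * (- t) ^ n)" for n
    proof -
      have "t ^ n / fact n * weight_coeff \<mu> \<nu> 0 (- int (Suc n))
          = t ^ n * of_nat (Suc n) * (1 ^ Suc n / fact (Suc n) * weight_coeff \<mu> \<nu> 0 (- int (Suc n)))"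
        by (simp add: field_simps del: of_nat_Suc)
      also have "\<dots> = - c * (fps_nth (fps_deriv F) n * (- t) ^ n)"
        unfolding coeffs by (simp add: power_minus[of t])
      finally show ?thesis by (simp add: algebra_simps)
    qed
    with weight_coeff_sums[OF re, of t "-1"]
    show "(\<lambda>n. - c * (fps_nth (fps_deriv F) n * (- t) ^ n)) sums weight_coeff \<mu> \<nu> t (-1)" by simp
  qed
  have "((\<lambda>s. eval_fps F (- s)) has_field_derivative eval_fps (fps_deriv F) (- t) * (- 1)) (at t)"
    by (rule DERIV_chain2[OF has_field_derivative_eval_fps]) (auto simp: conv intro!: derivative_eq_intros)
  then have "deriv (\<lambda>s. eval_fps F (- s)) t = - eval_fps (fps_deriv F) (- t)"
    by (simp add: DERIV_imp_deriv)
  then show ?thesis using c by (simp add: log_deriv_def kummer w0 w1)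
qed

theorem proposition4p3:
  fixes \<mu> \<nu> t :: complex and x y r rbar :: "nat \<Rightarrow> complex"
  defines "r \<equiv> refl_coeff \<mu> \<nu> t" and "rbar \<equiv> refl_coeff_bar \<mu> \<nu> t"
  assumes "Re (\<mu> + \<nu>) > -1" and "t \<noteq> 0"
    and "hamiltonian_variables \<mu> \<nu> t x y"
    and "\<And>N. toeplitz_det 0 \<mu> \<nu> t N \<noteq> 0"
    and "\<And>N. r N \<noteq> 0" and "\<And>N. rbar N \<noteq> 0"
    and "\<And>N. (x N - t / y N - \<mu> / 2) * (1 - y N) - \<nu> \<noteq> 0"
    and "\<And>N. rbar N * (t * r (N + 1) + (of_nat N + \<nu>) * r N) \<noteq> 0"
  shows
    "(\<forall>N. (1 / y N - 1) * (x N - t / y N - \<nu> - \<mu> / 2) + of_nat N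
            = (of_nat N + \<nu>) * (1 - r N * rbar N)) \<and>
     (\<forall>N. (x N - t / y N - \<nu> - \<mu> / 2)
              * (1 + (of_nat N + \<nu>) / ((x N - t / y N - \<mu> / 2) * (1 - y N) - \<nu>)) - of_nat N
            = t * (r (N + 1) / r N) * (1 - r N * rbar N)) \<and>
     (\<forall>N\<ge>1. (1 - y N) * (x N - t / y N + \<mu> / 2) + of_nat N
            = - t * (rbar (N - 1) / rbar N) * (1 - r N * rbar N)) \<and>
     (\<forall>N. y N = (\<nu> + t * r (N + 1) * rbar N)
                  / (rbar N * (t * r (N + 1) + (of_nat N + \<nu>) * r N))) \<and>
     (\<forall>N. x N - t / y N - \<mu> / 2 = - t * r (N + 1) * rbar N)"
proof -
  note ham = assms(5)[unfolded hamiltonian_variables_def]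
  interpret pearson_moments "weight_coeff \<mu> \<nu> t" \<mu> \<nu> t
  proof
    show "Determinant.det (Matrix.mat n n (\<lambda>(j, k). weight_coeff \<mu> \<nu> t (int j - int k))) \<noteq> 0"
      for n using assms(6)[of n] by (simp add: toeplitz_det_def)
  qed (rule weight_coeff_recurrence[OF assms(3)])
  have toep: "toep e = toeplitz_det e \<mu> \<nu> t" for e
    by (simp add: toep_def toeplitz_det_def fun_eq_iff)
  have r: "refl = r" and rbar: "refl_bar = rbar"
    by (simp_all add: refl_def refl_bar_def r_def rbar_def refl_coeff_def refl_coeff_bar_def toep
        fun_eq_iff)
  have det_1: "toeplitz_det e \<mu> \<nu> t (Suc 0) = weight_coeff \<mu> \<nu> t (- e)" for e
    by (simp add: toeplitz_det_def det_single)
  \<comment> \<open>The determinants of size one give \<open>refl 1\<close> as minus the quotient of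
    the coefficients of index -1 and 0, hence minus the logarithmic derivative.\<close>
  have x_0: "x 0 = t + \<mu> / 2 - t * refl 1"
    using ham log_deriv_kummer[OF assms(3), of t] assms(6)[of 1]
    by (simp add: r r_def refl_coeff_def det_1)
  have y_rec: "y n * y (Suc n)
      = t * (x n + of_nat n + 1 + \<nu> + \<mu> / 2) / ((x n)\<^sup>2 - \<mu>\<^sup>2 / 4)" for n
    using ham by simp
  have x_rec: "x (Suc n) + x n = t / y (Suc n) - of_nat (Suc n) / (1 - y (Suc n))"
    and y_neq_1: "1 - y (Suc n) \<noteq> 0" for n
    using ham by (metis One_nat_def Suc_le_mono diff_Suc_1 le0)+
  have refl_comb: "t * refl (Suc n) + (of_nat n + \<nu>) * refl n \<noteq> 0" for n
    using assms(10)[of n] by (simp add: r)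
  have y: "y 0 = 1" "y n \<noteq> 0" and denom: "(x n)\<^sup>2 - \<mu>\<^sup>2 / 4 \<noteq> 0" for n
    using ham by blast+
  note ids = x_y_refl_identities[OF assms(4) assms(8)[folded rbar] refl_comb x_0 y y_neq_1 denom
      x_rec y_rec assms(7)[folded r], unfolded r rbar]
  show ?thesis
    using ids(1) ids(2)[OF assms(9)] ids(3-5) by simp
qed

end
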